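(* If the general linear time discretization (GLTD) with coefficient matrices $\mathbf D_{11},\mathbf D_{12},\mathbf D_{21},\mathbf D_{22}$ is algebraically stable with a symmetric positive definite matrix $\mathbf G=(g_{ij})\in\mathbb R^{r\times r}$, then the fully discrete (Fourier spectral) SAV-GL scheme described in the context satisfies $$\frac12\sum_{i,j=1}^rg_{ij}\left\langle\mathcal L_h\circ\widehat{\mathbf u}_i^{[n+1]},\widehat{\mathbf u}_j^{[n+1]}\right\rangle+\left\|\mathbf z^{[n+1]}\right\|_{\mathbf G}^2\le\frac12\sum_{i,j=1}^rg_{ij}\left\langle\mathcal L_h\circ\widehat{\mathbf u}_i^{[n]},\widehat{\mathbf u}_j^{[n]}\right\rangle+\left\|\mathbf z^{[n]}\right\|_{\mathbf G}^2,$$ where $\mathbf z^{[n]}=(z_1^{[n]},\dots,z_r^{[n]})^T$ and $\|\boldsymbol\sigma\|_{\mathbf G}^2=\sum_{i,j=1}^rg_{ij}\sigma_i\sigma_j$ for $\boldsymbol\sigma\in\mathbb R^r$.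
   Context: Algebraic stability. Real matrices $\mathbf D_{11}\in\mathbb R^{s\times s}$, $\mathbf D_{12}\in\mathbb R^{s\times r}$, $\mathbf D_{21}\in\mathbb R^{r\times s}$, $\mathbf D_{22}\in\mathbb R^{r\times r}$, $\mathbf D_{\imath\jmath}=(d^{\imath\jmath}_{ij})$, define a GLTD ($U_{n,i}=\tau\sum_jd^{11}_{ij}f(U_{n,j})+\sum_jd^{12}_{ij}u_j^{[n]}$, $u_i^{[n+1]}=\tau\sum_jd^{21}_{ij}f(U_{n,j})+\sum_jd^{22}_{ij}u_j^{[n]}$ for $u'=f(u)$). It is algebraically stable if there are a symmetric positive definite $\mathbf G\in\mathbb R^{r\times r}$ and a non-negative definite diagonal $\mathbf H\in\mathbb R^{s\times s}$ such that $\begin{bmatrix}\mathbf G-\mathbf D_{22}^T\mathbf G\mathbf D_{22}&\mathbf D_{12}^T\mathbf H-\mathbf D_{22}^T\mathbf G\mathbf D_{21}\\ \mathbf H\mathbf D_{12}-\mathbf D_{21}^T\mathbf G\mathbf D_{22}&\mathbf D_{11}^T\mathbf H+\mathbf H\mathbf D_{11}-\mathbf D_{21}^T\mathbf G\mathbf D_{21}\end{bmatrix}$ is non-negative definite. Spatial setting. The gradient flow is $\partial_tu=\mathcal G\mu$, $\mu=\delta\mathcal F/\delta u$, $\mathcal F(u)=\frac12(\mathcal Lu,u)+\mathcal F_1(u)$, on $\Omega=(0,L)\times(0,L)$ with periodic boundary conditions, $\mathcal G$ symmetric non-positive, $\mathcal L$ symmetric non-negative linear (self-adjoint, elliptic),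 $\mathcal F_1+C_0>0$, $W(v)=\frac{1}{\sqrt{\mathcal F_1(v)+C_0}}\frac{\delta\mathcal F_1}{\delta u}(v)$. Let $N$ be even, $h=L/N$, $x_i=ih$, $y_j=jh$, $\mathcal V_h=\{\mathbf v=(v_{ij}):v_{ij}\in\mathbb R,\ 0\le i,j\le N-1\}$. The discrete Fourier coefficients of $\mathbf v\in\mathcal V_h$ are $\widehat v_{m,l}=\frac1{N^2}\sum_{i,j=0}^{N-1}v_{ij}e^{-\imath(\xi_mx_i+\eta_ly_j)}$, $-N/2\le m,l\le N/2-1$, $\xi_m=2\pi m/L$, $\eta_l=2\pi l/L$. For $N\times N$ arrays, $\circ$ is the entrywise (Schur) product and $\langle\phi,\psi\rangle=h^2\sum_{m,l}\phi_{m,l}\overline{\psi_{m,l}}$. $\mathcal G_h$ and $\mathcal L_h$ are the real $N\times N$ arrays of Fourier symbols of $\mathcal G$ and $\mathcal L$: $\mathcal G_h(m,l)=-1$ for $\mathcal G=-I$ ($L^2$ flow), $\mathcal G_h(m,l)=-(\xi_m^2+\eta_l^2)$ for $\mathcal G=\Delta$ ($H^{-1}$ flow), and e.g. $\mathcal L_h(m,l)=\alpha(\xi_m^2+\eta_l^2)+\beta$ for $\mathcal L=-\alpha\Delta+\beta$ with $\alpha>0$, $\beta\ge0$; in all cases the entries of $\mathcal L_h$ are $\ge0$. Scheme. Let $\mathbf u_i^{[n]}\in\mathcal V_h$, $z_i^{[n]}\in\mathbb R$ ($1\le i\le r$) and explicitly known (extrapolated) $\bar{\mathbf U}_{n,i}\in\mathcal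 V_h$ ($1\le i\le s$) be given, $\widehat W(\bar{\mathbf U}_{n,i})$ being the discrete Fourier coefficients of the real grid function $W(\bar{\mathbf U}_{n,i})$. With stepsize $\tau>0$, the real grid functions $\mathbf U_{n,i},\mathbf u_i^{[n+1]}\in\mathcal V_h$ (with discrete Fourier coefficients $\widehat{\mathbf U}_{n,i},\widehat{\mathbf u}_i^{[n+1]}$) and the real numbers $Z_{n,i},z_i^{[n+1]}$ satisfy $$\widehat{\mathbf U}_{n,i}=\tau\sum_{j=1}^sd^{11}_{ij}\dot{\widehat{\mathbf U}}_{n,j}+\sum_{j=1}^rd^{12}_{ij}\widehat{\mathbf u}_j^{[n]},\quad Z_{n,i}=\tau\sum_{j=1}^sd^{11}_{ij}\dot Z_{n,j}+\sum_{j=1}^rd^{12}_{ij}z_j^{[n]}\quad(1\le i\le s),$$ $$\widehat{\mathbf u}_i^{[n+1]}=\tau\sum_{j=1}^sd^{21}_{ij}\dot{\widehat{\mathbf U}}_{n,j}+\sum_{j=1}^rd^{22}_{ij}\widehat{\mathbf u}_j^{[n]},\quad z_i^{[n+1]}=\tau\sum_{j=1}^sd^{21}_{ij}\dot Z_{n,j}+\sum_{j=1}^rd^{22}_{ij}z_j^{[n]}\quad(1\le i\le r),$$ $$\dot{\widehat{\mathbf U}}_{n,i}=\mathcal G_h\circ\widehat{\boldsymbol\mu}_{n,i},\quad\widehat{\boldsymbol\mu}_{n,i}=\mathcal L_h\circ\widehat{\mathbf U}_{n,i}+Z_{n,i}\widehat W(\bar{\mathbf U}_{n,i}),\quad\dot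 Z_{n,i}=\tfrac12\left\langle\widehat W(\bar{\mathbf U}_{n,i}),\dot{\widehat{\mathbf U}}_{n,i}\right\rangle.$$ *)

theory Defs
  imports "HOL-Analysis.Analysis"
begin

section \<open>Algebraic stability\<close>

definition nonneg_definite :: "real^'n^'n \<Rightarrow> bool" where
  "nonneg_definite M \<longleftrightarrow> transpose M = M \<and> (\<forall>x. 0 \<le> x \<bullet> (M *v x))"

definition pos_definite :: "real^'n^'n \<Rightarrow> bool" where
  "pos_definite M \<longleftrightarrow> transpose M = M \<and> (\<forall>x. x \<noteq> 0 \<longrightarrow> 0 < x \<bullet> (M *v x))"

definition diagonal_matrix :: "real^'n^'n \<Rightarrow> bool" where
  "diagonal_matrix M \<longleftrightarrow> (\<forall>i j. i \<noteq> j \<longrightarrow> M $ i $ j = 0)"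

text \<open>The block matrix with rows (A, B) and (C, D); the sum type indexes the two blocks.\<close>

definition block_matrix ::
  "real^'r^'r \<Rightarrow> real^'s^'r \<Rightarrow> real^'r^'s \<Rightarrow> real^'s^'s \<Rightarrow> real^('r + 's)^('r + 's)" where
  "block_matrix A B C D = (\<chi> i j. case i of
      Inl a \<Rightarrow> (case j of Inl b \<Rightarrow> A $ a $ b | Inr b \<Rightarrow> B $ a $ b)
    | Inr a \<Rightarrow> (case j of Inl b \<Rightarrow> C $ a $ b | Inr b \<Rightarrow> D $ a $ b))"

definition algebraic_stability_matrix ::
  "real^'s^'s \<Rightarrow> real^'r^'s \<Rightarrow> real^'s^'r \<Rightarrow> real^'r^'r \<Rightarrow> real^'r^'r \<Rightarrow> real^'s^'s
    \<Rightarrow> real^('r + 's)^('r + 's)" where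
  "algebraic_stability_matrix D11 D12 D21 D22 G H = block_matrix
     (G - transpose D22 ** G ** D22)
     (transpose D12 ** H - transpose D22 ** G ** D21)
     (H ** D12 - transpose D21 ** G ** D22)
     (transpose D11 ** H + H ** D11 - transpose D21 ** G ** D21)"

text \<open>A GLTD is algebraically stable if this holds for some \<open>G\<close>; the energy uses that \<open>G\<close>.\<close>

definition algebraically_stable_with ::
  "real^'s^'s \<Rightarrow> real^'r^'s \<Rightarrow> real^'s^'r \<Rightarrow> real^'r^'r \<Rightarrow> real^'r^'r \<Rightarrow> bool" where
  "algebraically_stable_with D11 D12 D21 D22 G \<longleftrightarrow>
     pos_definite G \<and>
     (\<exists>H. diagonal_matrix H \<and> nonneg_definite H \<and>
          nonneg_definite (algebraic_stability_matrix D11 D12 D21 D22 G H))"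

definition wnorm_sq :: "real^'r^'r \<Rightarrow> real^'r \<Rightarrow> real" where
  "wnorm_sq G z = (\<Sum>i\<in>UNIV. \<Sum>j\<in>UNIV. G $ i $ j * z $ i * z $ j)"

section \<open>Operators on periodic functions and their Fourier symbols\<close>

definition wavenumber :: "real \<Rightarrow> int \<Rightarrow> real" where
  "wavenumber Len m = 2 * pi * of_int m / Len"

definition fourier_mode :: "real \<Rightarrow> int \<Rightarrow> int \<Rightarrow> real \<times> real \<Rightarrow> complex" where
  "fourier_mode Len m l p =
     exp (\<i> * of_real (wavenumber Len m * fst p + wavenumber Len l * snd p))"

definition torus_domain :: "real \<Rightarrow> (real \<times> real) set" where
  "torus_domain Len = {0<..<Len} \<times> {0<..<Len}"

definition L2_per :: "real \<Rightarrow> (real \<times> real \<Rightarrow> real) set" where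
  "L2_per Len = {u. u \<in> borel_measurable lborel \<and>
      (\<forall>x y. u (x + Len, y) = u (x, y) \<and> u (x, y + Len) = u (x, y)) \<and>
      set_integrable lborel (torus_domain Len) (\<lambda>p. (u p)\<^sup>2)}"

definition L2_inner :: "real \<Rightarrow> (real \<times> real \<Rightarrow> real) \<Rightarrow> (real \<times> real \<Rightarrow> real) \<Rightarrow> real" where
  "L2_inner Len u v = (LINT p:torus_domain Len|lborel. u p * v p)"

text \<open>Domain on which the (possibly unbounded) operators act, for instance the smooth periodic
  functions: a linear space of periodic functions containing all real Fourier modes.\<close>

definition operator_domain :: "real \<Rightarrow> (real \<times> real \<Rightarrow> real) set \<Rightarrow> bool" where
  "operator_domain Len V \<longleftrightarrow>
     V \<subseteq> L2_per Len \<and>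
     (\<forall>u\<in>V. \<forall>v\<in>V. (\<lambda>p. u p + v p) \<in> V) \<and>
     (\<forall>c. \<forall>u\<in>V. (\<lambda>p. c * u p) \<in> V) \<and>
     (\<forall>m l. (\<lambda>p. Re (fourier_mode Len m l p)) \<in> V \<and> (\<lambda>p. Im (fourier_mode Len m l p)) \<in> V)"

type_synonym operator = "(real \<times> real \<Rightarrow> real) \<Rightarrow> (real \<times> real \<Rightarrow> real)"

definition symmetric_operator :: "real \<Rightarrow> (real \<times> real \<Rightarrow> real) set \<Rightarrow> operator \<Rightarrow> bool" where
  "symmetric_operator Len V A \<longleftrightarrow>
     (\<forall>u\<in>V. A u \<in> L2_per Len) \<and>
     (\<forall>u\<in>V. \<forall>v\<in>V. A (\<lambda>p. u p + v p) = (\<lambda>p. A u p + A v p)) \<and>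
     (\<forall>c. \<forall>u\<in>V. A (\<lambda>p. c * u p) = (\<lambda>p. c * A u p)) \<and>
     (\<forall>u\<in>V. \<forall>v\<in>V. L2_inner Len (A u) v = L2_inner Len u (A v))"

definition nonneg_operator :: "real \<Rightarrow> (real \<times> real \<Rightarrow> real) set \<Rightarrow> operator \<Rightarrow> bool" where
  "nonneg_operator Len V A \<longleftrightarrow> (\<forall>u\<in>V. 0 \<le> L2_inner Len (A u) u)"

definition nonpos_operator :: "real \<Rightarrow> (real \<times> real \<Rightarrow> real) set \<Rightarrow> operator \<Rightarrow> bool" where
  "nonpos_operator Len V A \<longleftrightarrow> (\<forall>u\<in>V. L2_inner Len (A u) u \<le> 0)"

definition complexify :: "operator \<Rightarrow> (real \<times> real \<Rightarrow> complex) \<Rightarrow> (real \<times> real \<Rightarrow> complex)" where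
  "complexify A f = (\<lambda>p. Complex (A (\<lambda>q. Re (f q)) p) (A (\<lambda>q. Im (f q)) p))"

text \<open>\<open>a\<close> is the Fourier symbol of \<open>A\<close>: for instance \<open>a m l = -1\<close> for \<open>A = -I\<close>, and
  \<open>a m l = - (wavenumber Len m ^ 2 + wavenumber Len l ^ 2)\<close> for the Laplacian.\<close>

definition fourier_symbol :: "real \<Rightarrow> operator \<Rightarrow> (int \<Rightarrow> int \<Rightarrow> real) \<Rightarrow> bool" where
  "fourier_symbol Len A a \<longleftrightarrow>
     (\<forall>m l. complexify A (fourier_mode Len m l)
            = (\<lambda>p. of_real (a m l) * fourier_mode Len m l p))"

section \<open>Grid functions and Fourier arrays\<close>

text \<open>Only the entries with both indices below \<open>N\<close> (for grid functions), respectively in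
  \<open>freqs N\<close> (for arrays in Fourier space), are meaningful.\<close>

type_synonym grid_fun = "nat \<Rightarrow> nat \<Rightarrow> real"
type_synonym fourier_array = "int \<Rightarrow> int \<Rightarrow> complex"

definition freqs :: "nat \<Rightarrow> int set" where
  "freqs N = {- int (N div 2) .. int (N div 2) - 1}"

definition dft :: "real \<Rightarrow> nat \<Rightarrow> grid_fun \<Rightarrow> fourier_array" where
  "dft Len N v m l = 1 / (of_nat N)\<^sup>2 * (\<Sum>i<N. \<Sum>j<N. of_real (v i j) *
     exp (- (\<i> * of_real (wavenumber Len m * (of_nat i * (Len / of_nat N))
                        + wavenumber Len l * (of_nat j * (Len / of_nat N))))))"

definition schur :: "(int \<Rightarrow> int \<Rightarrow> real) \<Rightarrow> fourier_array \<Rightarrow> fourier_array" where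
  "schur A \<phi> = (\<lambda>m l. of_real (A m l) * \<phi> m l)"

definition array_inner :: "real \<Rightarrow> nat \<Rightarrow> fourier_array \<Rightarrow> fourier_array \<Rightarrow> complex" where
  "array_inner Len N \<phi> \<psi> =
     of_real ((Len / of_nat N)\<^sup>2) * (\<Sum>m\<in>freqs N. \<Sum>l\<in>freqs N. \<phi> m l * cnj (\<psi> m l))"

section \<open>The SAV-GL scheme\<close>

text \<open>\<open>F1\<close> and \<open>dF1\<close> are whatever evaluations on grid functions of the nonlinear part of the
  free energy and of its variational derivative the scheme uses; no relation between the
  two is imposed, since \<open>dF1\<close> need not be the exact gradient of a discretised functional.\<close>

definition sav_W :: "(grid_fun \<Rightarrow> real) \<Rightarrow> (grid_fun \<Rightarrow> grid_fun) \<Rightarrow> real \<Rightarrow> grid_fun \<Rightarrow> grid_fun" where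
  "sav_W F1 dF1 C0 v = (\<lambda>i j. 1 / sqrt (F1 v + C0) * dF1 v i j)"

definition sav_mu ::
  "real \<Rightarrow> nat \<Rightarrow> (int \<Rightarrow> int \<Rightarrow> real) \<Rightarrow> grid_fun \<Rightarrow> grid_fun \<Rightarrow> real \<Rightarrow> fourier_array" where
  "sav_mu Len N Lh w U Z = (\<lambda>m l. schur Lh (dft Len N U) m l + of_real Z * dft Len N w m l)"

definition sav_Udot ::
  "real \<Rightarrow> nat \<Rightarrow> (int \<Rightarrow> int \<Rightarrow> real) \<Rightarrow> (int \<Rightarrow> int \<Rightarrow> real)
    \<Rightarrow> grid_fun \<Rightarrow> grid_fun \<Rightarrow> real \<Rightarrow> fourier_array" where
  "sav_Udot Len N Gh Lh w U Z = schur Gh (sav_mu Len N Lh w U Z)"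

definition sav_Zdot ::
  "real \<Rightarrow> nat \<Rightarrow> (int \<Rightarrow> int \<Rightarrow> real) \<Rightarrow> (int \<Rightarrow> int \<Rightarrow> real)
    \<Rightarrow> grid_fun \<Rightarrow> grid_fun \<Rightarrow> real \<Rightarrow> complex" where
  "sav_Zdot Len N Gh Lh w U Z =
     1 / 2 * array_inner Len N (dft Len N w) (sav_Udot Len N Gh Lh w U Z)"

text \<open>One step from \<open>(u, z)\<close> to \<open>(u', z')\<close> with stages \<open>(U, Z)\<close>, where \<open>w i\<close> is the grid function
  \<open>W\<close> evaluated at the \<open>i\<close>-th extrapolated stage. The equations for the real numbers \<open>Z\<close> and
  \<open>z'\<close> are complex ones, because \<open>sav_Zdot\<close> is defined by a complex inner product.\<close>

definition sav_gl_step ::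
  "real \<Rightarrow> nat \<Rightarrow> real \<Rightarrow> real^'s^'s \<Rightarrow> real^'r^'s \<Rightarrow> real^'s^'r \<Rightarrow> real^'r^'r
    \<Rightarrow> (int \<Rightarrow> int \<Rightarrow> real) \<Rightarrow> (int \<Rightarrow> int \<Rightarrow> real) \<Rightarrow> ('s \<Rightarrow> grid_fun)
    \<Rightarrow> ('r \<Rightarrow> grid_fun) \<Rightarrow> real^'r \<Rightarrow> ('s \<Rightarrow> grid_fun) \<Rightarrow> real^'s
    \<Rightarrow> ('r \<Rightarrow> grid_fun) \<Rightarrow> real^'r \<Rightarrow> bool" where
  "sav_gl_step Len N \<tau> D11 D12 D21 D22 Gh Lh w u z U Z u' z' \<longleftrightarrow>
     (\<forall>i. \<forall>m\<in>freqs N. \<forall>l\<in>freqs N.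
        dft Len N (U i) m l =
          of_real \<tau> * (\<Sum>j\<in>UNIV. of_real (D11 $ i $ j) * sav_Udot Len N Gh Lh (w j) (U j) (Z $ j) m l)
          + (\<Sum>j\<in>UNIV. of_real (D12 $ i $ j) * dft Len N (u j) m l)) \<and>
     (\<forall>i. of_real (Z $ i) =
          of_real \<tau> * (\<Sum>j\<in>UNIV. of_real (D11 $ i $ j) * sav_Zdot Len N Gh Lh (w j) (U j) (Z $ j))
          + (\<Sum>j\<in>UNIV. of_real (D12 $ i $ j) * of_real (z $ j))) \<and>
     (\<forall>i. \<forall>m\<in>freqs N. \<forall>l\<in>freqs N.
        dft Len N (u' i) m l =
          of_real \<tau> * (\<Sum>j\<in>UNIV. of_real (D21 $ i $ j) * sav_Udot Len N Gh Lh (w j) (U j) (Z $ j) m l)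
          + (\<Sum>j\<in>UNIV. of_real (D22 $ i $ j) * dft Len N (u j) m l)) \<and>
     (\<forall>i. of_real (z' $ i) =
          of_real \<tau> * (\<Sum>j\<in>UNIV. of_real (D21 $ i $ j) * sav_Zdot Len N Gh Lh (w j) (U j) (Z $ j))
          + (\<Sum>j\<in>UNIV. of_real (D22 $ i $ j) * of_real (z $ j)))"

definition quadratic_energy_sum ::
  "real \<Rightarrow> nat \<Rightarrow> real^'r^'r \<Rightarrow> (int \<Rightarrow> int \<Rightarrow> real) \<Rightarrow> ('r \<Rightarrow> grid_fun) \<Rightarrow> complex" where
  "quadratic_energy_sum Len N G Lh u = (\<Sum>i\<in>UNIV. \<Sum>j\<in>UNIV. of_real (G $ i $ j) *
     array_inner Len N (schur Lh (dft Len N (u i))) (dft Len N (u j)))"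

text \<open>This sum is real, so that taking its real part loses nothing.\<close>

lemma quadratic_energy_sum_real:
  assumes "transpose G = G"
  shows "quadratic_energy_sum Len N G Lh u \<in> \<real>"
proof -
  have G: "G $ i $ j = G $ j $ i" for i j
    using assms by (metis transpose_def vec_lambda_beta)
  have "cnj (array_inner Len N (schur Lh \<phi>) \<psi>) = array_inner Len N (schur Lh \<psi>) \<phi>" for \<phi> \<psi>
    by (simp add: array_inner_def schur_def mult_ac)
  then have "cnj (quadratic_energy_sum Len N G Lh u) =
      (\<Sum>i\<in>UNIV. \<Sum>j\<in>UNIV. of_real (G $ i $ j) *
         array_inner Len N (schur Lh (dft Len N (u j))) (dft Len N (u i)))"
    by (simp add: quadratic_energy_sum_def)
  also have "\<dots> = (\<Sum>i\<in>UNIV. \<Sum>j\<in>UNIV. of_real (G $ j $ i) *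
         array_inner Len N (schur Lh (dft Len N (u j))) (dft Len N (u i)))"
    by (subst G) (rule refl)
  also have "\<dots> = quadratic_energy_sum Len N G Lh u"
    unfolding quadratic_energy_sum_def by (rule sum.swap)
  finally show ?thesis
    by (simp add: Reals_cnj_iff)
qed

end

theory Submission
  imports Defs
begin

text \<open>
  The scheme is, frequency by frequency, one step of the general linear method applied to the
  Fourier coefficient of \<open>u\<close>, and also one step of the same method applied to the scalar \<open>z\<close>.
  Algebraic stability is a statement about exactly such a step: evaluating the stability matrix at
  the vector \<open>(x, k)\<close>, with \<open>x\<close> the input and \<open>k\<close> the stage increments, the change of the
  \<open>G\<close>-norm is at most \<open>2 \<Sum>\<^sub>i h\<^sub>i k\<^sub>i X\<^sub>i\<close>, where \<open>X\<close> are the stages and \<open>h\<^sub>i \<ge> 0\<close> the diagonal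
  entries of \<open>H\<close> (lemma \<open>algebraically_stable_step\<close>).

  Apply this to the real and imaginary parts at each frequency, with the weight \<open>\<L>\<^sub>h \<ge> 0\<close>, and to
  \<open>z\<close>, and add up. The coefficient of \<open>h\<^sub>i\<close> on the right is, up to \<open>\<tau> > 0\<close>, the real part of
  \<open>\<langle>\<L>\<^sub>h \<circ> U\<^sub>i, dU\<^sub>i\<rangle> + 2 Z\<^sub>i dZ\<^sub>i\<close>. The equation for \<open>dZ\<^sub>i\<close> is made so that the second term equals
  \<open>\<langle>Z\<^sub>i W\<^sub>i, dU\<^sub>i\<rangle>\<close>; together they give \<open>\<langle>\<mu>\<^sub>i, dU\<^sub>i\<rangle> = \<langle>\<mu>\<^sub>i, \<G>\<^sub>h \<circ> \<mu>\<^sub>i\<rangle> \<le> 0\<close>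
  (lemma \<open>sav_stage_dissipation\<close>).

  The signs \<open>\<L>\<^sub>h \<ge> 0\<close> and \<open>\<G>\<^sub>h \<le> 0\<close> come from the operators, by testing their quadratic forms with
  the cosine and the sine part of a Fourier mode (lemma \<open>symbol_quadratic_form\<close>).
\<close>

section \<open>Signs of the Fourier symbols\<close>

text \<open>Neither the cosine nor the sine part alone has a norm independent of the frequency (the sine
  part vanishes at frequency zero), but their squares add up to one.\<close>

lemma symbol_quadratic_form:
  fixes a :: "int \<Rightarrow> int \<Rightarrow> real"
  assumes "Len > 0" and V: "operator_domain Len V" and A: "fourier_symbol Len A a"
  defines "c \<equiv> \<lambda>m l p. Re (fourier_mode Len m l p)"
    and "s \<equiv> \<lambda>m l p. Im (fourier_mode Len m l p)"
  shows "L2_inner Len (A (c m l)) (c m l) + L2_inner Len (A (s m l)) (s m l) = a m l * Len\<^sup>2"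
proof -
  have sym: "complexify A (fourier_mode Len m l) p = of_real (a m l) * fourier_mode Len m l p" for p
    using A unfolding fourier_symbol_def by metis
  have Ac: "A (c m l) = (\<lambda>p. a m l * c m l p)"
  proof
    fix p
    show "A (c m l) p = a m l * c m l p"
      using arg_cong[OF sym[of p], of Re] by (simp add: complexify_def c_def)
  qed
  have As: "A (s m l) = (\<lambda>p. a m l * s m l p)"
  proof
    fix p
    show "A (s m l) p = a m l * s m l p"
      using arg_cong[OF sym[of p], of Im] by (simp add: complexify_def s_def)
  qed
  have int_c: "set_integrable lborel (torus_domain Len) (\<lambda>p. (c m l p)\<^sup>2)"
    and int_s: "set_integrable lborel (torus_domain Len) (\<lambda>p. (s m l p)\<^sup>2)"
    using V unfolding operator_domain_def L2_per_def c_def s_def by blast+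
  have one: "(c m l p)\<^sup>2 + (s m l p)\<^sup>2 = 1" for p
    unfolding c_def s_def cmod_power2[symmetric] by (simp add: fourier_mode_def)
  have mult: "L2_inner Len (\<lambda>p. a m l * f p) f = a m l * (LINT p:torus_domain Len|lborel. (f p)\<^sup>2)" for f
    by (simp add: L2_inner_def power2_eq_square mult.assoc)
  have "(LINT p:torus_domain Len|lborel. (c m l p)\<^sup>2) + (LINT p:torus_domain Len|lborel. (s m l p)\<^sup>2)
      = (LINT p:torus_domain Len|lborel. 1)"
    using set_integral_add(2)[OF int_c int_s] by (simp add: one)
  also have "\<dots> = measure lborel (torus_domain Len)"
    by (simp add: set_lebesgue_integral_def)
  also have "\<dots> = Len\<^sup>2"
  proof -
    have "torus_domain Len = box (0, 0) (Len, Len)"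
      by (auto simp: torus_domain_def box_def Basis_prod_def)
    also have "measure lborel (box (0, 0) (Len, Len)) = measure lborel (cbox (0, 0) (Len, Len))"
      by (simp add: measure_lborel_box_eq measure_lborel_cbox_eq)
    finally show ?thesis
      using \<open>Len > 0\<close> by (simp add: content_Pair power2_eq_square)
  qed
  finally show ?thesis
    unfolding Ac As mult by (simp flip: distrib_left)
qed

lemma nonneg_operator_symbol:
  assumes "Len > 0" "operator_domain Len V" "fourier_symbol Len A a" "nonneg_operator Len V A"
  shows "0 \<le> a m l"
proof -
  have "0 \<le> a m l * Len\<^sup>2"
    unfolding symbol_quadratic_form[OF assms(1-3), symmetric]
    using assms(2,4) unfolding operator_domain_def nonneg_operator_def
    by (intro add_nonneg_nonneg) blast+
  then show ?thesis
    using \<open>Len > 0\<close> by (simp add: zero_le_mult_iff)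
qed

lemma nonpos_operator_symbol:
  assumes "Len > 0" "operator_domain Len V" "fourier_symbol Len A a" "nonpos_operator Len V A"
  shows "a m l \<le> 0"
proof -
  have "a m l * Len\<^sup>2 \<le> 0"
    unfolding symbol_quadratic_form[OF assms(1-3), symmetric]
    using assms(2,4) unfolding operator_domain_def nonpos_operator_def
    by (intro add_nonpos_nonpos) blast+
  then show ?thesis
    using \<open>Len > 0\<close> by (simp add: mult_le_0_iff)
qed

section \<open>One step of an algebraically stable method\<close>

lemma sum_UNIV_sum_type:
  fixes f :: "'a::finite + 'b::finite \<Rightarrow> real"
  shows "(\<Sum>i\<in>UNIV. f i) = (\<Sum>a\<in>UNIV. f (Inl a)) + (\<Sum>b\<in>UNIV. f (Inr b))"
  by (simp add: UNIV_Plus_UNIV[symmetric] sum.Plus comp_def del: UNIV_Plus_UNIV)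

lemma inner_block_matrix:
  fixes x :: "real^'r" and k :: "real^'s"
  defines "y \<equiv> \<chi> i. case i of Inl a \<Rightarrow> x $ a | Inr b \<Rightarrow> k $ b"
  shows "y \<bullet> (block_matrix A B C D *v y)
       = x \<bullet> (A *v x) + x \<bullet> (B *v k) + k \<bullet> (C *v x) + k \<bullet> (D *v k)"
  by (simp add: inner_vec_def matrix_vector_mult_def block_matrix_def y_def sum_UNIV_sum_type
      distrib_left sum.distrib)

lemma inner_transpose_matrix:
  fixes M :: "real^'n^'m"
  shows "x \<bullet> (transpose M *v y) = (M *v x) \<bullet> y"
  by (metis dot_lmul_matrix inner_commute transpose_matrix_vector)

lemma wnorm_sq_eq_inner: "wnorm_sq G x = x \<bullet> (G *v x)"
  by (simp add: wnorm_sq_def inner_vec_def matrix_vector_mult_def sum_distrib_left mult_ac)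

lemma inner_diagonal_matrix:
  assumes "diagonal_matrix H"
  shows "x \<bullet> (H *v y) = (\<Sum>i\<in>UNIV. H $ i $ i * x $ i * y $ i)"
proof -
  have "(H *v y) $ i = H $ i $ i * y $ i" for i
  proof -
    have "(H *v y) $ i = (\<Sum>j\<in>UNIV. if j = i then H $ i $ i * y $ i else 0)"
      using assms unfolding matrix_vector_mult_def diagonal_matrix_def vec_lambda_beta
      by (intro sum.cong) (auto dest: spec[of _ i])
    then show ?thesis
      by simp
  qed
  then show ?thesis
    by (simp add: inner_vec_def mult_ac)
qed

text \<open>The stability matrix is designed for this identity: its terms in \<open>G\<close> are those of expanding the
  \<open>G\<close>-norm of the output in \<open>(x, k)\<close>, and its terms in \<open>H\<close> are those of symmetrising the pairing of
  the increments with the stages.\<close>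

lemma stability_matrix_form:
  fixes x :: "real^'r" and k :: "real^'s"
  assumes G: "transpose G = G" and H: "transpose H = H"
  defines "y \<equiv> \<chi> i. case i of Inl a \<Rightarrow> x $ a | Inr b \<Rightarrow> k $ b"
  shows "y \<bullet> (algebraic_stability_matrix D11 D12 D21 D22 G H *v y)
       = wnorm_sq G x - wnorm_sq G (D21 *v k + D22 *v x)
         + 2 * (k \<bullet> (H *v (D11 *v k + D12 *v x)))"
proof -
  have G': "v \<bullet> (G *v w) = w \<bullet> (G *v v)" for v w
    using inner_transpose_matrix[of v G w] by (simp add: G inner_commute)
  have H': "v \<bullet> (H *v w) = w \<bullet> (H *v v)" for v w
    using inner_transpose_matrix[of v H w] by (simp add: H inner_commute)
  show ?thesis
    unfolding algebraic_stability_matrix_def y_def inner_block_matrix wnorm_sq_eq_inner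
    by (simp add: matrix_vector_mult_diff_rdistrib matrix_vector_mult_add_rdistrib
        matrix_vector_right_distrib inner_diff_right inner_add_right inner_add_left
        inner_transpose_matrix del: transpose_matrix_vector flip: matrix_vector_mul_assoc)
      (simp add: G'[of "D22 *v x" "D21 *v k"] H'[of "D12 *v x" k] H'[of "D11 *v k" k])
qed

text \<open>All that is used of algebraic stability. The weights \<open>h\<close> do not depend on \<open>x\<close> and \<open>k\<close>, so that the
  bounds for all frequencies and for the auxiliary variable can be added stage by stage.\<close>

lemma algebraically_stable_step:
  fixes D11 :: "real^'s^'s" and D12 :: "real^'r^'s"
  assumes "algebraically_stable_with D11 D12 D21 D22 G"
  obtains h :: "'s \<Rightarrow> real" where "\<And>i. 0 \<le> h i"
    and "\<And>x k. wnorm_sq G (D21 *v k + D22 *v x)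
            \<le> wnorm_sq G x + 2 * (\<Sum>i\<in>UNIV. h i * k $ i * (D11 *v k + D12 *v x) $ i)"
proof -
  obtain H where H: "diagonal_matrix H" "nonneg_definite H"
    and M: "nonneg_definite (algebraic_stability_matrix D11 D12 D21 D22 G H)"
    and G: "pos_definite G"
    using assms unfolding algebraically_stable_with_def by blast
  show thesis
  proof (rule that[of "\<lambda>i. H $ i $ i"])
    fix i
    have "0 \<le> axis i 1 \<bullet> (H *v axis i 1)"
      using H(2) unfolding nonneg_definite_def by blast
    then show "0 \<le> H $ i $ i"
      by (simp add: inner_axis' matrix_vector_mult_basis column_def)
  next
    fix x :: "real^'r" and k :: "real^'s"
    let ?y = "\<chi> i. case i of Inl a \<Rightarrow> x $ a | Inr b \<Rightarrow> k $ b"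
    have "0 \<le> ?y \<bullet> (algebraic_stability_matrix D11 D12 D21 D22 G H *v ?y)"
      using M unfolding nonneg_definite_def by blast
    also have "\<dots> = wnorm_sq G x - wnorm_sq G (D21 *v k + D22 *v x)
         + 2 * (k \<bullet> (H *v (D11 *v k + D12 *v x)))"
      using G H(2) by (intro stability_matrix_form) (simp_all add: pos_definite_def nonneg_definite_def)
    finally show "wnorm_sq G (D21 *v k + D22 *v x)
        \<le> wnorm_sq G x + 2 * (\<Sum>i\<in>UNIV. H $ i $ i * k $ i * (D11 *v k + D12 *v x) $ i)"
      by (simp add: inner_diagonal_matrix[OF H(1)])
  qed
qed

section \<open>Energy and dissipation in Fourier space\<close>

text \<open>For symmetric \<open>G\<close> this is the Hermitian form \<open>\<Sum>\<^sub>i\<^sub>j g\<^sub>i\<^sub>j x\<^sub>i cnj x\<^sub>j\<close>; splitting it into real and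
  imaginary parts lets the real step estimate act on each of them.\<close>

definition wnorm_sq_complex :: "real^'r^'r \<Rightarrow> ('r \<Rightarrow> complex) \<Rightarrow> real" where
  "wnorm_sq_complex G x = wnorm_sq G (\<chi> i. Re (x i)) + wnorm_sq G (\<chi> i. Im (x i))"

text \<open>The method has real coefficients, so the real and imaginary parts of a complex step are
  real steps of the same method.\<close>

lemma complex_step_bound:
  fixes h :: "'s::finite \<Rightarrow> real" and D11 :: "real^'s^'s" and D12 :: "real^'r^'s"
    and x x' :: "'r \<Rightarrow> complex" and k X :: "'s \<Rightarrow> complex"
  assumes step: "\<And>x k. wnorm_sq G (D21 *v k + D22 *v x)
            \<le> wnorm_sq G x + 2 * (\<Sum>i\<in>UNIV. h i * k $ i * (D11 *v k + D12 *v x) $ i)"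
    and X: "\<And>i. X i = of_real \<tau> * (\<Sum>j\<in>UNIV. of_real (D11 $ i $ j) * k j)
              + (\<Sum>j\<in>UNIV. of_real (D12 $ i $ j) * x j)"
    and x': "\<And>i. x' i = of_real \<tau> * (\<Sum>j\<in>UNIV. of_real (D21 $ i $ j) * k j)
              + (\<Sum>j\<in>UNIV. of_real (D22 $ i $ j) * x j)"
  shows "wnorm_sq_complex G x' \<le> wnorm_sq_complex G x + 2 * \<tau> * (\<Sum>i\<in>UNIV. h i * Re (X i * cnj (k i)))"
proof -
  \<comment> \<open>\<open>p\<close> stands for \<open>Re\<close> and for \<open>Im\<close>; the increments of the real step are \<open>\<tau> * p (k j)\<close>.\<close>
  have "wnorm_sq G (\<chi> i. p (x' i))
      \<le> wnorm_sq G (\<chi> i. p (x i)) + 2 * \<tau> * (\<Sum>i\<in>UNIV. h i * p (k i) * p (X i))"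
    if add: "\<And>a b. p (a + b) = p a + p b" and scale: "\<And>r a. p (of_real r * a) = r * p a"
      and p0: "p 0 = 0" for p :: "complex \<Rightarrow> real"
  proof -
    have sum: "p (sum f A) = (\<Sum>j\<in>A. p (f j))" for f and A :: "'b set"
      using sum_comp_morphism[of p f A, OF p0 add] by (simp add: comp_def)
    have "(D21 *v (\<chi> j. \<tau> * p (k j)) + D22 *v (\<chi> i. p (x i))) = (\<chi> i. p (x' i))"
      by (simp add: vec_eq_iff matrix_vector_mult_def x' add scale sum sum_distrib_left)
        (simp add: mult_ac)
    moreover have "(D11 *v (\<chi> j. \<tau> * p (k j)) + D12 *v (\<chi> i. p (x i))) $ i = p (X i)" for i
      by (simp add: matrix_vector_mult_def X add scale sum sum_distrib_left) (simp add: mult_ac)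
    ultimately show ?thesis
      using step[of "\<chi> j. \<tau> * p (k j)" "\<chi> i. p (x i)"] by (simp add: sum_distrib_left mult_ac)
  qed
  from this[of Re] this[of Im] show ?thesis
    by (simp add: wnorm_sq_complex_def algebra_simps sum.distrib sum_distrib_left)
qed

lemma Re_array_inner:
  "Re (array_inner Len N \<phi> \<psi>)
     = (Len / N)\<^sup>2 * (\<Sum>m\<in>freqs N. \<Sum>l\<in>freqs N. Re (\<phi> m l * cnj (\<psi> m l)))"
  unfolding array_inner_def
  by (simp only: scaleR_conv_of_real[symmetric] scaleR_complex.sel Re_sum)

lemma Re_quadratic_energy_sum:
  "Re (quadratic_energy_sum Len N G Lh u)
     = (Len / N)\<^sup>2 * (\<Sum>m\<in>freqs N. \<Sum>l\<in>freqs N. Lh m l * wnorm_sq_complex G (\<lambda>i. dft Len N (u i) m l))"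
proof -
  define q where "q i j m l = Lh m l * (G $ i $ j * Re (dft Len N (u i) m l * cnj (dft Len N (u j) m l)))"
    for i j m l
  have mode: "(\<Sum>i\<in>UNIV. \<Sum>j\<in>UNIV. q i j m l) = Lh m l * wnorm_sq_complex G (\<lambda>i. dft Len N (u i) m l)"
    for m l
    by (simp add: q_def wnorm_sq_complex_def wnorm_sq_def sum_distrib_left distrib_left mult.assoc sum.distrib)
  have "Re (quadratic_energy_sum Len N G Lh u)
      = (\<Sum>i\<in>UNIV. \<Sum>j\<in>UNIV. (Len / N)\<^sup>2 * (\<Sum>(m, l)\<in>freqs N \<times> freqs N. q i j m l))"
  proof -
    have "Re (of_real (G $ i $ j) * array_inner Len N (schur Lh (dft Len N (u i))) (dft Len N (u j)))
        = (Len / N)\<^sup>2 * (\<Sum>(m, l)\<in>freqs N \<times> freqs N. q i j m l)" for i j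
      unfolding scaleR_conv_of_real[symmetric] scaleR_complex.sel Re_array_inner schur_def q_def sum.cartesian_product[symmetric]
      by (simp add: sum_distrib_left mult.assoc distrib_left mult.left_commute flip: scaleR_conv_of_real)
    then show ?thesis
      unfolding quadratic_energy_sum_def Re_sum by simp
  qed
  also have "\<dots> = (Len / N)\<^sup>2 * (\<Sum>(m, l)\<in>freqs N \<times> freqs N. \<Sum>i\<in>UNIV. \<Sum>j\<in>UNIV. q i j m l)"
    by (simp only: sum_distrib_left[symmetric] case_prod_unfold
        sum.swap[of _ UNIV "freqs N \<times> freqs N"])
  finally show ?thesis
    by (simp only: mode sum.cartesian_product[symmetric])
qed

text \<open>This is where the auxiliary variable pays off: the work of the nonlinear force \<open>Z W\<close> along
  \<open>dU\<close> is exactly \<open>2 Z dZ\<close>, so only the total chemical potential \<open>\<mu>\<close> remains, on which the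
  non-positive mobility acts.\<close>

lemma sav_stage_dissipation:
  assumes Gh: "\<And>m l. Gh m l \<le> 0"
  shows "(Len / N)\<^sup>2 * (\<Sum>m\<in>freqs N. \<Sum>l\<in>freqs N. Lh m l *
            Re (dft Len N U m l * cnj (sav_Udot Len N Gh Lh w U Z m l)))
         + 2 * (Z * Re (sav_Zdot Len N Gh Lh w U Z)) \<le> 0"
proof -
  let ?mu = "sav_mu Len N Lh w U Z" and ?d = "sav_Udot Len N Gh Lh w U Z"
  have "2 * (Z * Re (sav_Zdot Len N Gh Lh w U Z))
      = (Len / N)\<^sup>2 * (\<Sum>m\<in>freqs N. \<Sum>l\<in>freqs N. Z * Re (dft Len N w m l * cnj (?d m l)))"
  proof -
    have "2 * Re (sav_Zdot Len N Gh Lh w U Z) = Re (array_inner Len N (dft Len N w) ?d)"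
      by (simp add: sav_Zdot_def)
    then have "2 * (Z * Re (sav_Zdot Len N Gh Lh w U Z)) = Z * Re (array_inner Len N (dft Len N w) ?d)"
      by simp
    then show ?thesis
      by (simp only: Re_array_inner sum_distrib_left mult.left_commute)
  qed
  then have "(Len / N)\<^sup>2 * (\<Sum>m\<in>freqs N. \<Sum>l\<in>freqs N. Lh m l * Re (dft Len N U m l * cnj (?d m l)))
         + 2 * (Z * Re (sav_Zdot Len N Gh Lh w U Z))
      = (Len / N)\<^sup>2 * (\<Sum>m\<in>freqs N. \<Sum>l\<in>freqs N. Re (?mu m l * cnj (?d m l)))"
    by (simp add: sav_mu_def schur_def ring_distribs sum.distrib sum_subtractf mult.assoc)
  also have "\<dots> = (Len / N)\<^sup>2 * (\<Sum>m\<in>freqs N. \<Sum>l\<in>freqs N. Gh m l * (cmod (?mu m l))\<^sup>2)"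
    unfolding sav_Udot_def schur_def cmod_power2
    by (simp add: algebra_simps power2_eq_square)
  also have "\<dots> \<le> 0"
    by (intro mult_nonneg_nonpos sum_nonpos mult_nonpos_nonneg Gh) simp_all
  finally show ?thesis .
qed

section \<open>Energy decay\<close>

theorem theorem5p1:
  fixes D11 :: "real^'s^'s" and D12 :: "real^'r^'s"
    and D21 :: "real^'s^'r" and D22 :: "real^'r^'r" and G :: "real^'r^'r"
    and Len \<tau> C0 :: real and N :: nat
    and V :: "(real \<times> real \<Rightarrow> real) set" and opG opL :: operator
    and Gh Lh :: "int \<Rightarrow> int \<Rightarrow> real"
    and F1 :: "grid_fun \<Rightarrow> real" and dF1 :: "grid_fun \<Rightarrow> grid_fun"
    and Ubar U :: "'s \<Rightarrow> grid_fun" and Z :: "real^'s"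
    and u u' :: "'r \<Rightarrow> grid_fun" and z z' :: "real^'r"
  assumes "Len > 0" and "N > 0" and "even N" and "\<tau> > 0"
    and "operator_domain Len V"
    and "symmetric_operator Len V opG" and "nonpos_operator Len V opG"
    and "symmetric_operator Len V opL" and "nonneg_operator Len V opL"
    and "fourier_symbol Len opG Gh" and "fourier_symbol Len opL Lh"
    and "\<forall>v. F1 v + C0 > 0"
    and "algebraically_stable_with D11 D12 D21 D22 G"
    and "sav_gl_step Len N \<tau> D11 D12 D21 D22 Gh Lh
           (\<lambda>i. sav_W F1 dF1 C0 (Ubar i)) u z U Z u' z'"
  shows "1 / 2 * Re (quadratic_energy_sum Len N G Lh u') + wnorm_sq G z'
       \<le> 1 / 2 * Re (quadratic_energy_sum Len N G Lh u) + wnorm_sq G z"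
proof -
  define w where "w i = sav_W F1 dF1 C0 (Ubar i)" for i
  define dU where "dU i = sav_Udot Len N Gh Lh (w i) (U i) (Z $ i)" for i
  define dZ where "dZ i = sav_Zdot Len N Gh Lh (w i) (U i) (Z $ i)" for i
  define c where "c = (Len / N)\<^sup>2"
  have Lh: "0 \<le> Lh m l" and Gh: "Gh m l \<le> 0" for m l
    using assms nonneg_operator_symbol nonpos_operator_symbol by blast+
  have "0 \<le> c"
    by (simp add: c_def)
  note scheme = assms(14)[unfolded sav_gl_step_def, folded w_def, folded dU_def dZ_def]
  obtain h where h: "\<And>i. 0 \<le> h i"
    and step: "\<And>x k. wnorm_sq G (D21 *v k + D22 *v x)
            \<le> wnorm_sq G x + 2 * (\<Sum>i\<in>UNIV. h i * k $ i * (D11 *v k + D12 *v x) $ i)"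
    using algebraically_stable_step[OF assms(13)] by blast
  define P where "P i = (\<Sum>m\<in>freqs N. \<Sum>l\<in>freqs N. Lh m l * Re (dft Len N (U i) m l * cnj (dU i m l)))"
    for i
  define E where "E x m l = wnorm_sq_complex G (\<lambda>i. dft Len N (x i) m l)" for x :: "'r \<Rightarrow> grid_fun" and m l
  define S where "S m l = (\<Sum>i\<in>UNIV. h i * Re (dft Len N (U i) m l * cnj (dU i m l)))" for m l
  have mode: "E u' m l \<le> E u m l + 2 * \<tau> * S m l" if "m \<in> freqs N" "l \<in> freqs N" for m l
    unfolding E_def S_def using scheme that by (intro complex_step_bound[OF step]) blast+
  have energy: "Re (quadratic_energy_sum Len N G Lh x) = c * (\<Sum>m\<in>freqs N. \<Sum>l\<in>freqs N. Lh m l * E x m l)"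
    for x
    unfolding E_def c_def by (rule Re_quadratic_energy_sum)
  have S_sum: "(\<Sum>m\<in>freqs N. \<Sum>l\<in>freqs N. Lh m l * S m l) = (\<Sum>i\<in>UNIV. h i * P i)"
    unfolding P_def S_def sum_distrib_left sum.swap[of _ UNIV "freqs N"]
    by (simp only: mult.left_commute)
  have "Re (quadratic_energy_sum Len N G Lh u')
      \<le> c * (\<Sum>m\<in>freqs N. \<Sum>l\<in>freqs N. Lh m l * (E u m l + 2 * \<tau> * S m l))"
    unfolding energy by (intro mult_left_mono sum_mono mode Lh \<open>0 \<le> c\<close>)
  also have "\<dots> = Re (quadratic_energy_sum Len N G Lh u)
      + 2 * \<tau> * (c * (\<Sum>m\<in>freqs N. \<Sum>l\<in>freqs N. Lh m l * S m l))"
    unfolding energy by (simp add: distrib_left sum.distrib sum_distrib_left mult_ac)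
  also have "c * (\<Sum>m\<in>freqs N. \<Sum>l\<in>freqs N. Lh m l * S m l) = (\<Sum>i\<in>UNIV. h i * (c * P i))"
    unfolding S_sum by (simp add: sum_distrib_left mult.left_commute)
  finally have u_bound: "Re (quadratic_energy_sum Len N G Lh u')
      \<le> Re (quadratic_energy_sum Len N G Lh u) + 2 * \<tau> * (\<Sum>i\<in>UNIV. h i * (c * P i))" .
  \<comment> \<open>The real variable \<open>z\<close> also goes through the complex estimate, because \<open>dZ\<close> is a complex number.\<close>
  have "wnorm_sq_complex G (\<lambda>i. of_real (z' $ i)) \<le> wnorm_sq_complex G (\<lambda>i. of_real (z $ i))
       + 2 * \<tau> * (\<Sum>i\<in>UNIV. h i * Re (of_real (Z $ i) * cnj (dZ i)))"
    using scheme by (intro complex_step_bound[OF step]) blast+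
  then have z_bound: "wnorm_sq G z' \<le> wnorm_sq G z + \<tau> * (\<Sum>i\<in>UNIV. h i * (2 * (Z $ i * Re (dZ i))))"
    by (simp add: wnorm_sq_complex_def wnorm_sq_def sum_distrib_left mult_ac)
  have "\<tau> * (\<Sum>i\<in>UNIV. h i * (c * P i + 2 * (Z $ i * Re (dZ i)))) \<le> 0"
    unfolding c_def P_def dU_def dZ_def
    using \<open>\<tau> > 0\<close> by (intro mult_nonneg_nonpos sum_nonpos h less_imp_le sav_stage_dissipation Gh)
  then have "\<tau> * (\<Sum>i\<in>UNIV. h i * (c * P i)) + \<tau> * (\<Sum>i\<in>UNIV. h i * (2 * (Z $ i * Re (dZ i)))) \<le> 0"
    by (simp only: distrib_left sum.distrib)
  then show ?thesis
    using u_bound z_bound by linarith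
qed

end
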